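(* Let $B$ be a strongly infinitely divisible nonnegative matrix. Then the following dichotomy holds: 1. If $B$ is irreducible, then $B$ is strictly positive (all entries are $>0$). 2. If $B$ is reducible, then there exists a permutation matrix $L$ such that $B=L U L^{T}$ for some infinitely divisible upper block triangular matrix $U$. Furthermore: (a) all the matrices on the diagonal blocks of $U$ are strictly positive; (b) if $M$ is the number of (diagonal) blocks in $U$, then for every $n \leq M$ the square submatrix $U^{(n)}$, obtained from $U$ by deleting the first $n$ blocks from the top rows and left columns, is strongly infinitely divisible.
   Context: Matrices are real and square. A matrix is nonnegative if all its entries are $\geq 0$, and strictly positive if all its entries are $>0$. A nonnegative matrix $B$ is infinitely divisible if there exists a sequence of nonnegative matrices $\{K_n\}_{n=1}^{\infty}$ such that $(K_n)^n = B$ for every $n\geq 1$; it is strongly infinitely divisible if in addition $\det(B)>0$. Irreducible/reducible are in the usual sense of nonnegative matrix (Perron--Frobenius) theory. In (b), when $n=M$ the submatrix $U^{(n)}$ is the empty matrix, for which the assertion is regarded as vacuous. *)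

theory Defs
  imports
    "Jordan_Normal_Form.Determinant"
    "Jordan_Normal_Form.DL_Submatrix"
    "HOL-Combinatorics.Permutations"
begin

definition nonneg_mat :: "real mat \<Rightarrow> bool" where
  "nonneg_mat A \<longleftrightarrow> (\<forall>i<dim_row A. \<forall>j<dim_col A. 0 \<le> A $$ (i, j))"

definition strictly_pos_mat :: "real mat \<Rightarrow> bool" where
  "strictly_pos_mat A \<longleftrightarrow> (\<forall>i<dim_row A. \<forall>j<dim_col A. 0 < A $$ (i, j))"

text \<open>The roots must be square of the size of \<open>B\<close>; the value \<open>K 0\<close> is irrelevant.
  The empty matrix satisfies both of the following predicates (its determinant is \<open>1\<close>).\<close>

definition infinitely_divisible_mat :: "real mat \<Rightarrow> bool" where
  "infinitely_divisible_mat B \<longleftrightarrow>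
     square_mat B \<and> nonneg_mat B \<and>
     (\<exists>K :: nat \<Rightarrow> real mat. \<forall>n\<ge>1.
        K n \<in> carrier_mat (dim_row B) (dim_row B) \<and> nonneg_mat (K n) \<and> K n ^\<^sub>m n = B)"

definition strongly_infinitely_divisible_mat :: "real mat \<Rightarrow> bool" where
  "strongly_infinitely_divisible_mat B \<longleftrightarrow> infinitely_divisible_mat B \<and> 0 < det B"

definition permutation_mat :: "nat \<Rightarrow> real mat \<Rightarrow> bool" where
  "permutation_mat d L \<longleftrightarrow>
     (\<exists>\<pi>. \<pi> permutes {..<d} \<and> L = mat d d (\<lambda>(i, j). if i = \<pi> j then 1 else 0))"

text \<open>Both square diagonal blocks are required to be nonempty, so a \<open>1 \<times> 1\<close> matrix is never
  reducible.\<close>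

definition reducible_mat :: "real mat \<Rightarrow> bool" where
  "reducible_mat A \<longleftrightarrow> square_mat A \<and>
     (\<exists>P r s X Y Z. permutation_mat (dim_row A) P \<and> 0 < r \<and> 0 < s \<and> r + s = dim_row A \<and>
        X \<in> carrier_mat r r \<and> Y \<in> carrier_mat r s \<and> Z \<in> carrier_mat s s \<and>
        P * A * transpose_mat P = four_block_mat X Y (0\<^sub>m s r) Z)"

definition irreducible_mat :: "real mat \<Rightarrow> bool" where
  "irreducible_mat A \<longleftrightarrow> square_mat A \<and> \<not> reducible_mat A"

text \<open>A block structure is given by the list \<open>ns\<close> of the (positive) sizes of the diagonal blocks.
  All indices start at \<open>0\<close>: block \<open>k\<close> occupies the rows (columns) from \<open>block_start ns k\<close> up to,
  but excluding, \<open>block_start ns (Suc k)\<close>.\<close>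

definition block_start :: "nat list \<Rightarrow> nat \<Rightarrow> nat" where
  "block_start ns k = sum_list (take k ns)"

definition mat_block :: "nat list \<Rightarrow> real mat \<Rightarrow> nat \<Rightarrow> nat \<Rightarrow> real mat" where
  "mat_block ns U k l =
     submatrix U {block_start ns k..<block_start ns (Suc k)}
                 {block_start ns l..<block_start ns (Suc l)}"

definition upper_block_triangular_mat :: "nat list \<Rightarrow> real mat \<Rightarrow> bool" where
  "upper_block_triangular_mat ns U \<longleftrightarrow>
     square_mat U \<and> (\<forall>m\<in>set ns. 0 < m) \<and> sum_list ns = dim_row U \<and>
     (\<forall>k<length ns. \<forall>l<k. mat_block ns U k l = 0\<^sub>m (ns ! k) (ns ! l))"

definition delete_leading_blocks :: "nat list \<Rightarrow> nat \<Rightarrow> real mat \<Rightarrow> real mat" where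
  "delete_leading_blocks ns n U = submatrix U {block_start ns n..} {block_start ns n..}"

end

theory Submission
  imports Defs "HOL-Library.Nat_Bijection" "HOL-Combinatorics.Cycles"
begin

text \<open>
  The zero pattern of \<open>B\<close> decides everything, so the proof works with the relation
  \<open>support_rel B\<close> of all \<open>(i, j)\<close> with \<open>B $$ (i, j) > 0\<close>. Powers of nonnegative matrices have no
  cancellation, so the relation of a power is the relational power.

  The key fact is that \<open>support_rel B\<close> is a preorder. If \<open>K ^ n = B\<close> then \<open>det K \<noteq> 0\<close>, so some term of
  the Leibniz formula for \<open>det K\<close> survives: the support of \<open>K\<close> contains the graph of a permutation.
  For one exponent \<open>N\<close> that kills all permutations of the indices, \<open>J = K ^ N\<close> then has a positive
  diagonal. Hence the supports of the powers of \<open>J\<close> increase, and from the power \<open>d * d\<close> on they equal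
  the reflexive transitive closure. Choosing \<open>n\<close> as a multiple of \<open>N * (d * d + 1)\<close> exhibits \<open>B\<close> as
  such a power. The same choice gives roots of \<open>B\<close> of every order with the very support of \<open>B\<close>
  (\<open>strongly_infinitely_divisible_support\<close>). Arbitrary roots need not have this property: the identity
  is the square of a transposition.

  Let an index set be closed if no arrow of \<open>support_rel B\<close> leaves it. Restricting matrices to it is
  then multiplicative as soon as the left factor has no arrow leaving the set. So the chosen roots
  restrict to roots of the restriction of \<open>B\<close>, and the inverse of \<open>B\<close> restricts to an inverse, which
  makes the determinant nonzero; being a square it is positive
  (\<open>strongly_infinitely_divisible_pullback\<close>). This one statement serves both for permuting the indices
  and for deleting leading blocks.

  If \<open>B $$ (i, j) = 0\<close> then the successors of \<open>i\<close> form a closed set that contains \<open>i\<close> but not \<open>j\<close>, and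
  moving it to the end shows that \<open>B\<close> is reducible. In general, list the equivalence classes of the
  preorder in an order compatible with it and sort the indices accordingly. The classes become the
  diagonal blocks: any two equivalent indices are related, so these blocks are strictly positive;
  no arrow goes back to an earlier class, so the blocks below the diagonal vanish and every union
  of trailing blocks is closed.
\<close>

section \<open>Powers of matrices\<close>

lemma index_mult_mat_sum:
  fixes A B :: "'a :: semiring_0 mat"
  assumes "A \<in> carrier_mat m k" "B \<in> carrier_mat k n" "i < m" "j < n"
  shows "(A * B) $$ (i, j) = (\<Sum>l = 0..<k. A $$ (i, l) * B $$ (l, j))"
  using assms by (auto simp: scalar_prod_def)

lemma pow_mat_add:
  fixes A :: "'a :: semiring_1 mat"
  assumes A: "A \<in> carrier_mat d d"
  shows "A ^\<^sub>m (m + n) = A ^\<^sub>m m * A ^\<^sub>m n"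
proof (induction n)
  case 0
  then show ?case using A by simp
next
  case (Suc n)
  have "A ^\<^sub>m (m + Suc n) = A ^\<^sub>m m * A ^\<^sub>m n * A" using Suc by simp
  also have "\<dots> = A ^\<^sub>m m * (A ^\<^sub>m n * A)"
    by (rule assoc_mult_mat[of _ d d _ d _ d]) (use A in \<open>auto intro: pow_carrier_mat\<close>)
  finally show ?case by simp
qed

lemma pow_mat_mult:
  fixes A :: "'a :: semiring_1 mat"
  assumes A: "A \<in> carrier_mat d d"
  shows "A ^\<^sub>m (m * n) = (A ^\<^sub>m m) ^\<^sub>m n"
proof (induction n)
  case 0
  then show ?case using A pow_carrier_mat[OF A, of m] by simp
next
  case (Suc n)
  have "A ^\<^sub>m (m * Suc n) = A ^\<^sub>m (m * n + m)" by (simp add: add.commute)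
  also have "\<dots> = A ^\<^sub>m (m * n) * A ^\<^sub>m m" by (rule pow_mat_add[OF A])
  finally show ?case using Suc by simp
qed

lemma det_pow_mat:
  fixes A :: "'a :: comm_ring_1 mat"
  assumes A: "A \<in> carrier_mat d d"
  shows "det (A ^\<^sub>m n) = det A ^ n"
proof (induction n)
  case 0
  then show ?case using A by simp
next
  case (Suc n)
  have "det (A ^\<^sub>m Suc n) = det (A ^\<^sub>m n) * det A"
    using det_mult[OF pow_carrier_mat[OF A] A] by simp
  then show ?case using Suc by simp
qed

lemma nonneg_mat_mult:
  assumes "A \<in> carrier_mat m k" "B \<in> carrier_mat k n" "nonneg_mat A" "nonneg_mat B"
  shows "nonneg_mat (A * B)"
  using assms by (auto simp: nonneg_mat_def scalar_prod_def intro!: sum_nonneg)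

lemma nonneg_mat_pow:
  assumes A: "A \<in> carrier_mat d d" and nn: "nonneg_mat A"
  shows "nonneg_mat (A ^\<^sub>m n)"
proof (induction n)
  case 0
  then show ?case by (auto simp: nonneg_mat_def)
next
  case (Suc n)
  then show ?case using nonneg_mat_mult[OF pow_carrier_mat[OF A] A _ nn] by simp
qed

section \<open>The support of a nonnegative matrix as a relation\<close>

text \<open>The indices are bounded by the dimensions because the entries outside them are unspecified.\<close>

definition support_rel :: "real mat \<Rightarrow> (nat \<times> nat) set" where
  "support_rel A = {(i, j). i < dim_row A \<and> j < dim_col A \<and> 0 < A $$ (i, j)}"

lemma support_subset: "A \<in> carrier_mat m n \<Longrightarrow> support_rel A \<subseteq> {..<m} \<times> {..<n}"
  by (auto simp: support_rel_def)

lemma nonzero_in_support: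
  assumes "A \<in> carrier_mat m n" "nonneg_mat A" "i < m" "j < n" "A $$ (i, j) \<noteq> 0"
  shows "(i, j) \<in> support_rel A"
proof -
  have "0 \<le> A $$ (i, j)" using assms(1-4) by (auto simp: nonneg_mat_def)
  then show ?thesis using assms by (auto simp: support_rel_def)
qed

text \<open>A sum of nonnegative products is positive exactly if one of its terms is.\<close>

lemma support_mult:
  assumes A: "A \<in> carrier_mat m k" and B: "B \<in> carrier_mat k n"
    and "nonneg_mat A" "nonneg_mat B"
  shows "support_rel (A * B) = support_rel A O support_rel B"
proof -
  have "0 < (A * B) $$ (i, j) \<longleftrightarrow> (\<exists>l<k. 0 < A $$ (i, l) \<and> 0 < B $$ (l, j))"
    if ij: "i < m" "j < n" for i j
  proof -
    have nonneg: "0 \<le> A $$ (i, l)" "0 \<le> B $$ (l, j)" if "l < k" for l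
      using assms ij that by (auto simp: nonneg_mat_def)
    have eq: "(A * B) $$ (i, j) = (\<Sum>l = 0..<k. A $$ (i, l) * B $$ (l, j))"
      by (rule index_mult_mat_sum[OF A B ij])
    have "0 \<le> (A * B) $$ (i, j)"
      unfolding eq using nonneg by (auto intro!: sum_nonneg)
    moreover have "(A * B) $$ (i, j) = 0 \<longleftrightarrow> (\<forall>l\<in>{0..<k}. A $$ (i, l) * B $$ (l, j) = 0)"
      unfolding eq using nonneg by (intro sum_nonneg_eq_0_iff) auto
    ultimately have "0 < (A * B) $$ (i, j) \<longleftrightarrow> (\<exists>l\<in>{0..<k}. A $$ (i, l) * B $$ (l, j) \<noteq> 0)"
      unfolding less_le by metis
    moreover have "A $$ (i, l) * B $$ (l, j) \<noteq> 0 \<longleftrightarrow> 0 < A $$ (i, l) \<and> 0 < B $$ (l, j)"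
      if "l < k" for l using nonneg[OF that] by auto
    ultimately show ?thesis by auto
  qed
  then show ?thesis using A B by (auto simp: support_rel_def relcomp_unfold)
qed

text \<open>The intersection only matters for exponent \<open>0\<close>, where the relational power is the identity on
  all natural numbers.\<close>

lemma support_pow:
  assumes A: "A \<in> carrier_mat d d" and nn: "nonneg_mat A"
  shows "support_rel (A ^\<^sub>m n) = support_rel A ^^ n \<inter> {..<d} \<times> {..<d}"
proof (induction n)
  case 0
  then show ?case using A by (auto simp: support_rel_def split: if_splits)
next
  case (Suc n)
  have "support_rel (A ^\<^sub>m Suc n) = support_rel (A ^\<^sub>m n) O support_rel A"
    using support_mult[OF pow_carrier_mat[OF A] A nonneg_mat_pow[OF A nn] nn] by simp
  also have "\<dots> = support_rel A ^^ Suc n \<inter> {..<d} \<times> {..<d}"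
    using support_subset[OF A] unfolding Suc by auto
  finally show ?case .
qed

text \<open>Otherwise every term of the Leibniz formula would vanish.\<close>

lemma nonsingular_support_permutation:
  assumes A: "A \<in> carrier_mat d d" and nn: "nonneg_mat A" and det: "det A \<noteq> 0"
  obtains p where "p permutes {0..<d}" "\<And>i. i < d \<Longrightarrow> (i, p i) \<in> support_rel A"
proof -
  have "(\<Sum>p\<in>{p. p permutes {0..<d}}. signof p * (\<Prod>i = 0..<d. A $$ (i, p i))) \<noteq> 0"
    using det det_def'[OF A] by simp
  then obtain p where p: "p permutes {0..<d}" "signof p * (\<Prod>i = 0..<d. A $$ (i, p i)) \<noteq> 0"
    by (metis (mono_tags, lifting) mem_Collect_eq sum.neutral)
  have "(i, p i) \<in> support_rel A" if "i < d" for i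
  proof -
    have "p i < d" using permutes_in_image[OF p(1), of i] that by simp
    moreover have "A $$ (i, p i) \<noteq> 0" using p(2) that by auto
    ultimately show ?thesis using nonzero_in_support[OF A nn that] by simp
  qed
  with p(1) show ?thesis by (rule that)
qed

text \<open>The exponent has to be fixed before a root of \<open>B\<close> is chosen, and the permutation found in the
  support depends on that root; hence one exponent for all permutations. The product of their
  orders serves.\<close>

lemma permutes_uniform_exponent:
  assumes "finite S"
  obtains N where "0 < N" "\<And>p. p permutes S \<Longrightarrow> p ^^ N = id"
proof -
  have "\<exists>m>0. p ^^ m = id" if "p permutes S" for p
    using permutation_is_nilpotent that assms permutation_permutes by metis
  then obtain m where m: "\<And>p. p permutes S \<Longrightarrow> 0 < m p \<and> p ^^ m p = id"
    by metis
  let ?P = "{p. p permutes S}"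
  have fin: "finite ?P" using assms by (rule finite_permutations)
  have "0 < prod m ?P" by (rule prod_pos) (use m in auto)
  moreover have "p ^^ prod m ?P = id" if "p permutes S" for p
  proof -
    have "m p dvd prod m ?P" using that fin by (intro dvd_prodI) auto
    then obtain c where "prod m ?P = m p * c" by (rule dvdE)
    then have "p ^^ prod m ?P = (p ^^ m p) ^^ c" by (simp only: funpow_mult)
    then show ?thesis using m[OF that] by (simp add: id_funpow)
  qed
  ultimately show ?thesis by (rule that)
qed

lemma relpow_funpow: "(\<And>i. i \<in> S \<Longrightarrow> (i, p i) \<in> R) \<Longrightarrow> p ` S \<subseteq> S \<Longrightarrow> i \<in> S
    \<Longrightarrow> (i, (p ^^ n) i) \<in> R ^^ n \<and> (p ^^ n) i \<in> S"
  by (induction n) (auto intro: relpow_Suc_I)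

text \<open>Every path can be shortened to length at most \<open>card R\<close>, and then extended to length exactly \<open>n\<close>
  by loops at its end. The bound \<open>d * d\<close> is crude but depends on nothing except \<open>d\<close>.\<close>

lemma rtrancl_eq_relpow_if_refl:
  assumes R: "R \<subseteq> {..<d} \<times> {..<d}" and refl: "\<And>i. i < d \<Longrightarrow> (i, i) \<in> R" and n: "d * d \<le> n"
  shows "R ^^ n \<inter> {..<d} \<times> {..<d} = R\<^sup>* \<inter> {..<d} \<times> {..<d}"
proof -
  have fin: "finite R" using R by (rule finite_subset) simp
  have card: "card R \<le> d * d" using card_mono[OF _ R] by (simp add: card_cartesian_product)
  have mono: "(i, j) \<in> R ^^ n" if "(i, j) \<in> R ^^ m" "j < d" "m \<le> n" for i j m
    using that(3,1) by (induction rule: dec_induct) (use refl that(2) in \<open>auto intro: relpow_Suc_I\<close>)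
  have "R ^^ n \<subseteq> R\<^sup>*" by (auto intro: relpow_imp_rtrancl)
  then show ?thesis
    using card n by (auto simp: rtrancl_finite_eq_relpow[OF fin] intro!: mono)
qed

text \<open>Take a root \<open>K\<close> of order \<open>N * (m * n)\<close>. Its power \<open>J = K ^ N\<close> has a positive diagonal, and the
  exponent \<open>m\<close> already saturates the support of \<open>J\<close>. So \<open>J ^ m\<close>, an \<open>n\<close>-th root of \<open>B\<close>, has the same
  support as \<open>B = J ^ (m * n)\<close>, namely the reflexive transitive closure of the support of \<open>J\<close>.\<close>

lemma strongly_infinitely_divisible_support:
  assumes B: "strongly_infinitely_divisible_mat B" and dim: "dim_row B = d"
  shows "\<And>i. i < d \<Longrightarrow> (i, i) \<in> support_rel B"
    and "trans (support_rel B)"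
    and "\<And>n. 1 \<le> n \<Longrightarrow> \<exists>Q\<in>carrier_mat d d. nonneg_mat Q \<and> Q ^\<^sub>m n = B \<and> support_rel Q = support_rel B"
proof -
  obtain N where N: "0 < N" "\<And>p. p permutes {0..<d} \<Longrightarrow> p ^^ N = id"
    using permutes_uniform_exponent[of "{0..<d}"] by auto
  \<comment> \<open>The successor keeps the order of the root positive when \<open>d = 0\<close>.\<close>
  define m where "m = Suc (d * d)"
  have "\<exists>Q\<in>carrier_mat d d. \<exists>R. nonneg_mat Q \<and> Q ^\<^sub>m n = B \<and> (\<forall>i<d. (i, i) \<in> R)
      \<and> support_rel Q = R\<^sup>* \<inter> {..<d} \<times> {..<d} \<and> support_rel B = R\<^sup>* \<inter> {..<d} \<times> {..<d}"
    if n: "1 \<le> n" for n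
  proof -
    have "1 \<le> N * (m * n)" using N n by (simp add: m_def)
    with B dim obtain K where K: "K \<in> carrier_mat d d" "nonneg_mat K" "K ^\<^sub>m (N * (m * n)) = B"
      unfolding strongly_infinitely_divisible_mat_def infinitely_divisible_mat_def by metis
    have "det B \<noteq> 0" using B by (simp add: strongly_infinitely_divisible_mat_def)
    then have "det K \<noteq> 0" using K det_pow_mat[OF K(1)] N n by (metis power_0_left power_eq_0_iff
          \<open>1 \<le> N * (m * n)\<close> not_one_le_zero)
    then obtain p where p: "p permutes {0..<d}" "\<And>i. i < d \<Longrightarrow> (i, p i) \<in> support_rel K"
      using nonsingular_support_permutation[OF K(1,2)] by blast
    define J where "J = K ^\<^sub>m N"
    have J: "J \<in> carrier_mat d d" "nonneg_mat J" "J ^\<^sub>m (m * n) = B"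
      using K by (auto simp: J_def pow_mat_mult[OF K(1)] nonneg_mat_pow)
    have refl: "(i, i) \<in> support_rel J" if "i < d" for i
    proof -
      have "(i, (p ^^ N) i) \<in> support_rel K ^^ N"
        using relpow_funpow[of "{0..<d}" p "support_rel K" i N] p that permutes_image[OF p(1)] by auto
      then show ?thesis
        unfolding J_def support_pow[OF K(1,2)] using N(2)[OF p(1)] that by simp
    qed
    have supp: "support_rel (J ^\<^sub>m k) = (support_rel J)\<^sup>* \<inter> {..<d} \<times> {..<d}" if "d * d \<le> k" for k
      unfolding support_pow[OF J(1,2)]
      using rtrancl_eq_relpow_if_refl[OF support_subset[OF J(1)] refl that] .
    have "d * d \<le> m * n" using n by (cases n) (auto simp: m_def)
    then have "support_rel B = (support_rel J)\<^sup>* \<inter> {..<d} \<times> {..<d}" using supp J(3) by metis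
    moreover have "(J ^\<^sub>m m) ^\<^sub>m n = B" using J(3) pow_mat_mult[OF J(1)] by metis
    moreover have "support_rel (J ^\<^sub>m m) = (support_rel J)\<^sup>* \<inter> {..<d} \<times> {..<d}"
      by (rule supp) (simp add: m_def)
    ultimately show ?thesis
      using refl nonneg_mat_pow[OF J(1,2), of m] pow_carrier_mat[OF J(1), of m] by blast
  qed
  note roots = this
  obtain R where R: "\<forall>i<d. (i, i) \<in> R" "support_rel B = R\<^sup>* \<inter> {..<d} \<times> {..<d}"
    using roots[of 1] by auto
  show "(i, i) \<in> support_rel B" if "i < d" for i using R that by auto
  show "trans (support_rel B)" unfolding R(2) by (auto intro!: transI)
  show "\<exists>Q\<in>carrier_mat d d. nonneg_mat Q \<and> Q ^\<^sub>m n = B \<and> support_rel Q = support_rel B" if n: "1 \<le> n" for n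
  proof -
    from roots[OF n] obtain Q R' where "Q \<in> carrier_mat d d" "nonneg_mat Q" "Q ^\<^sub>m n = B"
      "support_rel Q = R'\<^sup>* \<inter> {..<d} \<times> {..<d}" "support_rel B = R'\<^sup>* \<inter> {..<d} \<times> {..<d}"
      by (elim bexE exE conjE)
    then show ?thesis by (intro bexI[of _ Q] conjI) simp_all
  qed
qed

section \<open>Principal submatrices on closed index sets\<close>

text \<open>For \<open>g\<close> injective this is the principal submatrix on the range of \<open>g\<close>, listed in the order given
  by \<open>g\<close>. It covers both simultaneous permutations of rows and columns and trailing submatrices.\<close>

definition pullback_mat :: "nat \<Rightarrow> (nat \<Rightarrow> nat) \<Rightarrow> 'a mat \<Rightarrow> 'a mat" where
  "pullback_mat m g A = mat m m (\<lambda>(i, j). A $$ (g i, g j))"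

lemma pullback_mat_carrier [simp]: "pullback_mat m g A \<in> carrier_mat m m"
  by (simp add: pullback_mat_def)

lemma pullback_mat_dim [simp]:
  "dim_row (pullback_mat m g A) = m" "dim_col (pullback_mat m g A) = m"
  by (simp_all add: pullback_mat_def)

text \<open>An entry of the product sums over paths of length two. Their first step stays in the range of
  \<open>g\<close>, so the restricted sum misses no nonzero term. Only the left factor is constrained, which is
  what allows the right factor to be an inverse matrix.\<close>

lemma pullback_mat_mult:
  fixes A C :: "'a :: semiring_0 mat"
  assumes A: "A \<in> carrier_mat d d" and C: "C \<in> carrier_mat d d"
    and inj: "inj_on g {..<m}" and g: "g ` {..<m} \<subseteq> {..<d}"
    and closed: "\<And>i k. i \<in> g ` {..<m} \<Longrightarrow> k < d \<Longrightarrow> A $$ (i, k) \<noteq> 0 \<Longrightarrow> k \<in> g ` {..<m}"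
  shows "pullback_mat m g (A * C) = pullback_mat m g A * pullback_mat m g C"
proof (rule eq_matI)
  fix i j assume "i < dim_row (pullback_mat m g A * pullback_mat m g C)"
    "j < dim_col (pullback_mat m g A * pullback_mat m g C)"
  then have ij: "i < m" "j < m" by auto
  then have gij: "g i < d" "g j < d" using g by auto
  have "pullback_mat m g (A * C) $$ (i, j) = (\<Sum>k\<in>{..<d}. A $$ (g i, k) * C $$ (k, g j))"
    using A C ij gij by (simp add: pullback_mat_def scalar_prod_def atLeast0LessThan)
  also have "\<dots> = (\<Sum>k\<in>g ` {..<m}. A $$ (g i, k) * C $$ (k, g j))"
    using closed[of "g i"] ij g by (intro sum.mono_neutral_right) fastforce+
  also have "\<dots> = (\<Sum>k\<in>{..<m}. A $$ (g i, g k) * C $$ (g k, g j))"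
    by (simp add: sum.reindex[OF inj])
  also have "\<dots> = (pullback_mat m g A * pullback_mat m g C) $$ (i, j)"
    using ij by (simp add: pullback_mat_def scalar_prod_def atLeast0LessThan)
  finally show "pullback_mat m g (A * C) $$ (i, j) = (pullback_mat m g A * pullback_mat m g C) $$ (i, j)" .
qed auto

lemma pullback_mat_one:
  assumes "inj_on g {..<m}" "g ` {..<m} \<subseteq> {..<d}"
  shows "pullback_mat m g (1\<^sub>m d) = 1\<^sub>m m"
proof (rule eq_matI)
  fix i j assume "i < dim_row (1\<^sub>m m)" "j < dim_col (1\<^sub>m m)"
  then show "pullback_mat m g (1\<^sub>m d) $$ (i, j) = 1\<^sub>m m $$ (i, j)"
    using assms by (auto simp: pullback_mat_def image_subset_iff inj_on_def)
qed auto

lemma pullback_mat_pow: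
  fixes A :: "'a :: semiring_1 mat"
  assumes A: "A \<in> carrier_mat d d"
    and inj: "inj_on g {..<m}" and g: "g ` {..<m} \<subseteq> {..<d}"
    and closed: "\<And>i k. i \<in> g ` {..<m} \<Longrightarrow> k < d \<Longrightarrow> A $$ (i, k) \<noteq> 0 \<Longrightarrow> k \<in> g ` {..<m}"
  shows "pullback_mat m g (A ^\<^sub>m n) = pullback_mat m g A ^\<^sub>m n"
proof (induction n)
  case 0
  then show ?case using A pullback_mat_one[OF inj g] by simp
next
  case (Suc n)
  have "A ^\<^sub>m Suc n = A * A ^\<^sub>m n"
    using pow_mat_add[OF A, of 1 n] A by simp
  then have "pullback_mat m g (A ^\<^sub>m Suc n) = pullback_mat m g A * pullback_mat m g A ^\<^sub>m n"
    using pullback_mat_mult[OF A pow_carrier_mat[OF A] inj g closed] Suc by simp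
  also have "\<dots> = pullback_mat m g A ^\<^sub>m Suc n"
    using pow_mat_add[OF pullback_mat_carrier, of m g A 1 n] by simp
  finally show ?case .
qed

lemma nonneg_pullback_mat:
  assumes "A \<in> carrier_mat d d" "nonneg_mat A" "g ` {..<m} \<subseteq> {..<d}"
  shows "nonneg_mat (pullback_mat m g A)"
  using assms by (auto simp: nonneg_mat_def pullback_mat_def image_subset_iff)

text \<open>Roots with the support of \<open>B\<close> restrict to roots. The determinant of the restriction is the square
  of that of a restricted square root, and it does not vanish because an inverse of \<open>B\<close> restricts
  to an inverse.\<close>

lemma strongly_infinitely_divisible_pullback:
  assumes B: "strongly_infinitely_divisible_mat B" and dim: "dim_row B = d"
    and inj: "inj_on g {..<m}" and g: "g ` {..<m} \<subseteq> {..<d}"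
    and closed: "\<And>i k. i \<in> g ` {..<m} \<Longrightarrow> (i, k) \<in> support_rel B \<Longrightarrow> k \<in> g ` {..<m}"
  shows "strongly_infinitely_divisible_mat (pullback_mat m g B)"
proof -
  have Bc: "B \<in> carrier_mat d d" and nn: "nonneg_mat B" and det: "det B \<noteq> 0"
    using B dim unfolding strongly_infinitely_divisible_mat_def infinitely_divisible_mat_def by auto
  have closed': "k \<in> g ` {..<m}"
    if Q: "Q \<in> carrier_mat d d" "nonneg_mat Q" "support_rel Q = support_rel B"
      and ik: "i \<in> g ` {..<m}" "k < d" "Q $$ (i, k) \<noteq> 0" for Q i k
  proof (rule closed[OF ik(1)])
    show "(i, k) \<in> support_rel B"
      using nonzero_in_support[OF Q(1,2) _ ik(2,3)] ik(1) g Q(3) by auto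
  qed
  have roots: "\<exists>P. P \<in> carrier_mat m m \<and> nonneg_mat P \<and> P ^\<^sub>m n = pullback_mat m g B"
    if "1 \<le> n" for n
  proof -
    obtain Q where Q: "Q \<in> carrier_mat d d" "nonneg_mat Q" "Q ^\<^sub>m n = B" "support_rel Q = support_rel B"
      using strongly_infinitely_divisible_support(3)[OF B dim \<open>1 \<le> n\<close>] by blast
    have "pullback_mat m g Q ^\<^sub>m n = pullback_mat m g B"
      using pullback_mat_pow[OF Q(1) inj g closed'[OF Q(1,2,4)], where n = n] Q(3) by simp
    then show ?thesis using nonneg_pullback_mat[OF Q(1,2) g] by (intro exI[of _ "pullback_mat m g Q"]) auto
  qed
  then obtain P where P: "\<forall>n\<ge>1. P n \<in> carrier_mat m m \<and> nonneg_mat (P n) \<and> P n ^\<^sub>m n = pullback_mat m g B"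
    by metis
  then have inf: "infinitely_divisible_mat (pullback_mat m g B)"
    unfolding infinitely_divisible_mat_def using nonneg_pullback_mat[OF Bc nn g]
    by (auto intro!: exI[of _ P])
  have "det (P 2) ^ 2 = det (pullback_mat m g B)"
    using P[rule_format, of 2] det_pow_mat[of "P 2" m 2] by simp
  then have "0 \<le> det (pullback_mat m g B)" by (metis zero_le_power2)
  moreover have "det (pullback_mat m g B) \<noteq> 0"
  proof -
    obtain C where C: "C \<in> carrier_mat d d" "B * C = 1\<^sub>m d"
      using det_non_zero_imp_unit[OF Bc det, of "()"] unfolding Units_def ring_mat_def by auto
    have closed_B: "k \<in> g ` {..<m}" if "i \<in> g ` {..<m}" "k < d" "B $$ (i, k) \<noteq> 0" for i k
      using that by (rule closed'[OF Bc nn refl])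
    have "pullback_mat m g B * pullback_mat m g C = 1\<^sub>m m"
    proof -
      have "pullback_mat m g (B * C) = pullback_mat m g B * pullback_mat m g C"
        by (rule pullback_mat_mult[OF Bc C(1) inj g]) (rule closed_B)
      then show ?thesis unfolding C(2) pullback_mat_one[OF inj g] by simp
    qed
    then have "det (pullback_mat m g B) * det (pullback_mat m g C) = 1"
      using det_mult[of "pullback_mat m g B" m "pullback_mat m g C"] by simp
    then show ?thesis by auto
  qed
  ultimately show ?thesis using inf by (simp add: strongly_infinitely_divisible_mat_def)
qed

section \<open>Sorting the indices\<close>

text \<open>The name \<open>inv\<close> is qualified because the group-theoretic inverse shares its notation.\<close>

lemma permutation_mat_conjugate:
  assumes p: "p permutes {..<d}" and A: "A \<in> carrier_mat d d"
    and L: "L = mat d d (\<lambda>(i, j). if i = p j then 1 else (0 :: real))"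
  shows "L * A * transpose_mat L = pullback_mat d (Hilbert_Choice.inv p) A"
proof (rule eq_matI)
  fix i j assume "i < dim_row (pullback_mat d (Hilbert_Choice.inv p) A)"
    "j < dim_col (pullback_mat d (Hilbert_Choice.inv p) A)"
  then have ij: "i < d" "j < d" by auto
  have inv: "Hilbert_Choice.inv p k < d" if "k < d" for k
    using permutes_in_image[OF permutes_inv[OF p], of k] that by simp
  have eq: "i = p k \<longleftrightarrow> k = Hilbert_Choice.inv p i" for i k using permutes_inverses[OF p] by metis
  have LA: "(L * A) $$ (i, k) = A $$ (Hilbert_Choice.inv p i, k)" if "k < d" for k
    using A ij that inv[of i]
    by (simp add: L scalar_prod_def eq if_distrib[of "\<lambda>x. x * _"] cong: if_cong)
  have Lc: "L \<in> carrier_mat d d" by (simp add: L)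
  have "(L * A * transpose_mat L) $$ (i, j) = (\<Sum>k = 0..<d. (L * A) $$ (i, k) * transpose_mat L $$ (k, j))"
    by (rule index_mult_mat_sum[of _ d d _ d]) (use Lc A ij in auto)
  also have "\<dots> = (\<Sum>k = 0..<d. A $$ (Hilbert_Choice.inv p i, k) * L $$ (j, k))"
    by (intro sum.cong refl) (use Lc ij LA in \<open>simp del: index_mult_mat(1)\<close>)
  also have "\<dots> = A $$ (Hilbert_Choice.inv p i, Hilbert_Choice.inv p j)"
    using ij inv[of j] by (simp add: L eq if_distrib[of "\<lambda>x. _ * x"] cong: if_cong)
  finally show "(L * A * transpose_mat L) $$ (i, j) = pullback_mat d (Hilbert_Choice.inv p) A $$ (i, j)"
    using ij by (simp add: pullback_mat_def)
qed (use A in \<open>auto simp: L\<close>)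

lemma sorting_permutation:
  fixes f :: "nat \<Rightarrow> 'b :: linorder"
  obtains p where "p permutes {..<d}" "\<And>i j. i \<le> j \<Longrightarrow> j < d \<Longrightarrow> f (p i) \<le> f (p j)"
proof -
  define xs where "xs = sort_key f [0..<d]"
  have xs: "distinct xs" "length xs = d" "set xs = {..<d}" by (auto simp: xs_def)
  define p where "p = (\<lambda>i. if i < d then xs ! i else i)"
  have "bij_betw ((!) xs) {..<d} {..<d}" using xs by (intro bij_betw_nth) auto
  then have "bij_betw p {..<d} {..<d}" by (rule iffD1[OF bij_betw_cong, rotated]) (simp add: p_def)
  then have "p permutes {..<d}" by (rule bij_imp_permutes) (simp add: p_def)
  moreover have "f (p i) \<le> f (p j)" if "i \<le> j" "j < d" for i j
  proof -
    have "sorted (map f xs)" by (simp add: xs_def)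
    then have "map f xs ! i \<le> map f xs ! j" using that xs by (intro sorted_nth_mono) auto
    then show ?thesis using that xs by (simp add: p_def)
  qed
  ultimately show ?thesis by (rule that)
qed

lemma mono_sublevel_initial_segment:
  fixes g :: "nat \<Rightarrow> 'b :: linorder"
  assumes mono: "\<And>i j. i \<le> j \<Longrightarrow> j < d \<Longrightarrow> g i \<le> g j" and i: "i < d"
  shows "g i < v \<longleftrightarrow> i < card {j. j < d \<and> g j < v}"
proof
  assume "g i < v"
  then have "{..i} \<subseteq> {j. j < d \<and> g j < v}" using i mono[of _ i] by (auto intro: le_less_trans)
  then have "card {..i} \<le> card {j. j < d \<and> g j < v}" by (intro card_mono) auto
  then show "i < card {j. j < d \<and> g j < v}" by simp
next
  assume "i < card {j. j < d \<and> g j < v}"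
  moreover have "card {j. j < d \<and> g j < v} \<le> card {..<i}" if "\<not> g i < v"
  proof (intro card_mono subsetI)
    fix j assume j: "j \<in> {j. j < d \<and> g j < v}"
    show "j \<in> {..<i}"
    proof (rule ccontr)
      assume "j \<notin> {..<i}"
      then have "g i \<le> g j" using j by (intro mono) auto
      then show False using j that by auto
    qed
  qed auto
  ultimately show "g i < v" by fastforce
qed

text \<open>A preorder on indices has a compatible enumeration of its equivalence classes. The level of \<open>i\<close>
  should depend on its down-set only, and grow with it. Coding the down-set as the number with
  these binary digits is injective and monotone; replacing each code by its rank among all codes
  makes the levels consecutive, so that no block is empty.\<close>

lemma preorder_levels:
  fixes R :: "(nat \<times> nat) set"
  assumes R: "R \<subseteq> {..<d} \<times> {..<d}" and refl: "\<And>i. i < d \<Longrightarrow> (i, i) \<in> R" and trans: "trans R"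
  obtains f :: "nat \<Rightarrow> nat" and M where "f ` {..<d} = {..<M}"
    "\<And>i j. (i, j) \<in> R \<Longrightarrow> f i \<le> f j"
    "\<And>i j. i < d \<Longrightarrow> j < d \<Longrightarrow> f i = f j \<Longrightarrow> (i, j) \<in> R"
proof -
  define h where "h i = set_encode {k. (k, i) \<in> R}" for i
  define H where "H = h ` {..<d}"
  define f' where "f' v = card {w\<in>H. w < v}" for v
  have fin: "finite {k. (k, i) \<in> R}" for i
    by (rule finite_subset[of _ "{..<d}"]) (use R in auto)
  have finH: "finite H" by (simp add: H_def)
  have h_mono: "h i \<le> h j" if "(i, j) \<in> R" for i j
    unfolding h_def set_encode_def using that trans fin
    by (intro sum_mono2) (auto dest: transD)
  have h_eq: "(i, j) \<in> R" if "i < d" "h i = h j" for i j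
    using that refl fin unfolding h_def by (auto simp: set_encode_eq)
  have f'_less: "f' v < f' w" if "v \<in> H" "v < w" for v w
    unfolding f'_def using that finH by (intro psubset_card_mono) auto
  have f'_inj: "inj_on f' H"
    by (rule inj_onI) (metis f'_less less_irrefl linorder_cases)
  have f'_mono: "f' v \<le> f' w" if "v \<le> w" for v w
    unfolding f'_def using that finH by (intro card_mono) auto
  have "f' v < card H" if "v \<in> H" for v
    unfolding f'_def using that finH by (intro psubset_card_mono) auto
  then have "f' ` H = {..<card H}"
    using f'_inj finH by (intro card_subset_eq) (auto simp: card_image)
  then have "(f' \<circ> h) ` {..<d} = {..<card H}" by (simp add: H_def image_comp)
  moreover have "(f' \<circ> h) i \<le> (f' \<circ> h) j" if "(i, j) \<in> R" for i j
    using h_mono[OF that] f'_mono by simp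
  moreover have "(i, j) \<in> R" if "i < d" "j < d" "(f' \<circ> h) i = (f' \<circ> h) j" for i j
    using that f'_inj by (auto intro!: h_eq simp: H_def dest: inj_onD)
  ultimately show ?thesis by (rule that)
qed

section \<open>Submatrices on intervals of indices\<close>

lemma pick_interval:
  assumes "{a..<b} \<subseteq> I" "I \<subseteq> {a..}" "a + i < b"
  shows "pick I i = a + i"
  using assms(3)
proof (induction i)
  case 0
  then show ?case using assms(1,2) by (auto intro!: Least_equality)
next
  case (Suc i)
  then have "pick I i = a + i" by simp
  then show ?case using assms(1,2) Suc.prems by (auto intro!: Least_equality)
qed

text \<open>The index sets may go beyond the matrix, since \<open>delete_leading_blocks\<close> uses unbounded ones.\<close>

lemma submatrix_interval:
  assumes I: "{a..<b} \<subseteq> I" "I \<subseteq> {a..}" "{i. i < dim_row A \<and> i \<in> I} = {a..<b}"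
    and J: "{a'..<b'} \<subseteq> J" "J \<subseteq> {a'..}" "{j. j < dim_col A \<and> j \<in> J} = {a'..<b'}"
  shows "submatrix A I J = mat (b - a) (b' - a') (\<lambda>(i, j). A $$ (a + i, a' + j))"
  by (rule eq_matI) (auto simp: submatrix_def I(3) J(3) pick_interval[OF I(1,2)] pick_interval[OF J(1,2)])

section \<open>Irreducibility and block triangular form\<close>

text \<open>Sorting the indices by membership moves \<open>S\<close> to the end; the entries with row in \<open>S\<close> and column
  outside \<open>S\<close> then form the lower left block.\<close>

lemma reducible_mat_closed_set:
  assumes A: "A \<in> carrier_mat d d" and S: "S \<subset> {..<d}" "S \<noteq> {}"
    and zero: "\<And>i k. i \<in> S \<Longrightarrow> k < d \<Longrightarrow> k \<notin> S \<Longrightarrow> A $$ (i, k) = 0"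
  shows "reducible_mat A"
proof -
  define f where "f i = (if i \<in> S then 1 else 0 :: nat)" for i
  obtain p where p: "p permutes {..<d}" and mono: "\<And>i j. i \<le> j \<Longrightarrow> j < d \<Longrightarrow> f (p i) \<le> f (p j)"
    using sorting_permutation[where f = f and d = d] by metis
  define r where "r = card {j. j < d \<and> f (p j) < 1}"
  have r: "p i \<in> S \<longleftrightarrow> \<not> i < r" if "i < d" for i
    using mono_sublevel_initial_segment[of d "\<lambda>i. f (p i)" i 1, OF mono that]
    unfolding r_def[symmetric] by (simp add: f_def split: if_splits)
  have p_less: "p i < d" if "i < d" for i using permutes_in_image[OF p, of i] that by simp
  have surj: "\<exists>i<d. p i = k" if "k < d" for k
    using permutes_image[OF p] that by (metis image_iff lessThan_iff)
  obtain k where "k < d" "k \<notin> S" using S by auto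
  with surj r have "0 < r" by (metis not_less_zero gr0I)
  obtain k where "k < d" "k \<in> S" using S by auto
  with surj r have "r < d" by (metis not_le_imp_less order.strict_trans1)
  let ?A = "pullback_mat d p A" and ?P = "mat d d (\<lambda>(i, j). if i = Hilbert_Choice.inv p j then 1 else (0 :: real))"
  define s where "s = d - r"
  define X Y Z where "X = mat r r (\<lambda>(i, j). ?A $$ (i, j))"
    and "Y = mat r s (\<lambda>(i, j). ?A $$ (i, j + r))"
    and "Z = mat s s (\<lambda>(i, j). ?A $$ (i + r, j + r))"
  have "?P * A * transpose_mat ?P = ?A"
    using permutation_mat_conjugate[OF permutes_inv[OF p] A refl] permutes_inv_inv[OF p] by simp
  also have "?A = four_block_mat X Y (0\<^sub>m s r) Z"
  proof (rule eq_matI)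
    fix i j assume "i < dim_row (four_block_mat X Y (0\<^sub>m s r) Z)"
      "j < dim_col (four_block_mat X Y (0\<^sub>m s r) Z)"
    then have ij: "i < d" "j < d" using \<open>r < d\<close> by (auto simp: X_def Z_def s_def)
    have "?A $$ (i, j) = 0" if "\<not> i < r" "j < r"
      using r[OF ij(1)] r[OF ij(2)] that zero p_less ij by (simp add: pullback_mat_def)
    then show "?A $$ (i, j) = four_block_mat X Y (0\<^sub>m s r) Z $$ (i, j)"
      using ij \<open>r < d\<close> by (auto simp: X_def Y_def Z_def s_def)
  qed (use \<open>r < d\<close> in \<open>auto simp: X_def Z_def s_def\<close>)
  finally have eq: "?P * A * transpose_mat ?P = four_block_mat X Y (0\<^sub>m s r) Z" .
  have "permutation_mat d ?P"
    unfolding permutation_mat_def using permutes_inv[OF p] by blast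
  moreover have "X \<in> carrier_mat r r" "Y \<in> carrier_mat r s" "Z \<in> carrier_mat s s"
    by (simp_all add: X_def Y_def Z_def)
  moreover have "0 < s" "r + s = d" using \<open>r < d\<close> by (simp_all add: s_def)
  moreover have "square_mat A" and dim: "dim_row A = d" using A by simp_all
  ultimately show ?thesis
    unfolding reducible_mat_def dim using eq \<open>0 < r\<close>
    by (intro conjI exI[of _ ?P] exI[of _ r] exI[of _ s] exI[of _ X] exI[of _ Y] exI[of _ Z])
qed

text \<open>By transitivity the successors of \<open>i\<close> form a closed set; by reflexivity it contains \<open>i\<close>. A zero
  entry \<open>(i, j)\<close> would make it a proper subset.\<close>

lemma irreducible_strictly_pos:
  assumes B: "strongly_infinitely_divisible_mat B" and irr: "irreducible_mat B"
  shows "strictly_pos_mat B"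
proof -
  define d where "d = dim_row B"
  have Bc: "B \<in> carrier_mat d d" and nn: "nonneg_mat B"
    using B unfolding strongly_infinitely_divisible_mat_def infinitely_divisible_mat_def
    by (auto simp: d_def)
  note supp = strongly_infinitely_divisible_support[OF B d_def[symmetric]]
  have "0 < B $$ (i, j)" if ij: "i < d" "j < d" for i j
  proof (rule ccontr)
    assume "\<not> 0 < B $$ (i, j)"
    let ?S = "{k. (i, k) \<in> support_rel B}"
    have "?S \<subseteq> {..<d}" "j \<notin> ?S" "i \<in> ?S"
      using support_subset[OF Bc] \<open>\<not> 0 < B $$ (i, j)\<close> supp(1)[OF ij(1)] by (auto simp: support_rel_def)
    moreover have "B $$ (k, l) = 0" if kl: "k \<in> ?S" "l < d" "l \<notin> ?S" for k l
    proof -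
      have "(k, l) \<notin> support_rel B" using kl transD[OF supp(2)] by blast
      moreover have "k < d" using kl support_subset[OF Bc] by auto
      ultimately show ?thesis using nonzero_in_support[OF Bc nn, of k l] kl(2) by blast
    qed
    ultimately have "reducible_mat B"
      using ij by (intro reducible_mat_closed_set[OF Bc, of ?S]) auto
    then show False using irr by (simp add: irreducible_mat_def)
  qed
  then show ?thesis using Bc by (auto simp: strictly_pos_mat_def)
qed

text \<open>The map \<open>g\<close> sends an index to the number of its block. As it is monotone, the indices with
  \<open>g i < k\<close> form an initial segment, which ends where block \<open>k\<close> starts. Every claim about blocks
  thereby turns into one about levels.\<close>

lemma sorted_block_structure:
  assumes U: "strongly_infinitely_divisible_mat U" and dim: "dim_row U = d"
    and mono: "\<And>i j. i \<le> j \<Longrightarrow> j < d \<Longrightarrow> g i \<le> g j" and img: "g ` {..<d} = {..<M}"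
    and supp_le: "\<And>i j. (i, j) \<in> support_rel U \<Longrightarrow> g i \<le> g j"
    and supp_eq: "\<And>i j. i < d \<Longrightarrow> j < d \<Longrightarrow> g i = g j \<Longrightarrow> (i, j) \<in> support_rel U"
  defines "ns \<equiv> map (\<lambda>k. card {i. i < d \<and> g i = k}) [0..<M]"
  shows "upper_block_triangular_mat ns U"
    and "\<forall>k<length ns. strictly_pos_mat (mat_block ns U k k)"
    and "\<forall>n\<le>length ns. strongly_infinitely_divisible_mat (delete_leading_blocks ns n U)"
proof -
  have Uc: "U \<in> carrier_mat d d" and nn: "nonneg_mat U"
    using U dim unfolding strongly_infinitely_divisible_mat_def infinitely_divisible_mat_def by auto
  have len: "length ns = M" by (simp add: ns_def)
  have nth: "ns ! k = card {i. i < d \<and> g i = k}" if "k < M" for k using that by (simp add: ns_def)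
  have start_Suc: "block_start ns (Suc k) = block_start ns k + ns ! k" if "k < M" for k
    using that by (simp add: block_start_def take_Suc_conv_app_nth len)
  have start: "block_start ns k = card {i. i < d \<and> g i < k}" if "k \<le> M" for k
    using that
  proof (induction k)
    case 0
    then show ?case by (simp add: block_start_def)
  next
    case (Suc k)
    have "block_start ns (Suc k) = block_start ns k + ns ! k"
      using Suc.prems start_Suc by simp
    also have "\<dots> = card {i. i < d \<and> g i < k} + card {i. i < d \<and> g i = k}"
      using Suc nth by simp
    also have "\<dots> = card ({i. i < d \<and> g i < k} \<union> {i. i < d \<and> g i = k})"
      by (intro card_Un_disjoint[symmetric]) auto
    also have "{i. i < d \<and> g i < k} \<union> {i. i < d \<and> g i = k} = {i. i < d \<and> g i < Suc k}" by auto
    finally show ?case .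
  qed
  have start_iff: "i < block_start ns k \<longleftrightarrow> g i < k" if "k \<le> M" "i < d" for i k
    using mono_sublevel_initial_segment[of d g i k, OF mono that(2)] start[OF that(1)] by simp
  have start_le: "block_start ns k \<le> d" if "k \<le> M" for k
    unfolding start[OF that] using card_mono[of "{..<d}" "{i. i < d \<and> g i < k}"] by auto
  have in_block: "block_start ns k + i < d \<and> g (block_start ns k + i) = k"
    if "k < M" "i < ns ! k" for i k
  proof -
    let ?i = "block_start ns k + i"
    have less: "?i < block_start ns (Suc k)" using that start_Suc by simp
    then have "?i < d" using start_le[of "Suc k"] that by simp
    moreover have "g ?i < Suc k" using less start_iff[of "Suc k" ?i] that \<open>?i < d\<close> by simp
    moreover have "\<not> g ?i < k" using start_iff[of k ?i] that \<open>?i < d\<close> by simp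
    ultimately show ?thesis by simp
  qed
  have block: "mat_block ns U k l =
      mat (ns ! k) (ns ! l) (\<lambda>(i, j). U $$ (block_start ns k + i, block_start ns l + j))"
    if "k < M" "l < M" for k l
  proof -
    let ?I = "\<lambda>k. {block_start ns k..<block_start ns (Suc k)}"
    have "submatrix U (?I k) (?I l) = mat (block_start ns (Suc k) - block_start ns k)
        (block_start ns (Suc l) - block_start ns l)
        (\<lambda>(i, j). U $$ (block_start ns k + i, block_start ns l + j))"
      using Uc start_le[of "Suc k"] start_le[of "Suc l"] that
      by (intro submatrix_interval) auto
    then show ?thesis using that by (simp add: mat_block_def start_Suc)
  qed
  show "upper_block_triangular_mat ns U"
    unfolding upper_block_triangular_mat_def
  proof (intro conjI ballI allI impI)
    show "square_mat U" using Uc by simp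
    show "0 < m" if "m \<in> set ns" for m
    proof -
      obtain k where k: "k < M" "m = card {i. i < d \<and> g i = k}" using \<open>m \<in> set ns\<close> by (auto simp: ns_def)
      then have "k \<in> g ` {..<d}" using img by simp
      then have "{i. i < d \<and> g i = k} \<noteq> {}" by auto
      then show ?thesis using k by (simp add: card_gt_0_iff)
    qed
    have "{i. i < d \<and> g i < M} = {..<d}" using img by auto
    then show "sum_list ns = dim_row U" using start[of M] dim by (simp add: block_start_def len)
    show "mat_block ns U k l = 0\<^sub>m (ns ! k) (ns ! l)" if "k < length ns" "l < k" for k l
    proof (rule eq_matI)
      fix i j assume "i < dim_row (0\<^sub>m (ns ! k) (ns ! l))" "j < dim_col (0\<^sub>m (ns ! k) (ns ! l))"
      then have ij: "i < ns ! k" "j < ns ! l" by auto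
      let ?i = "block_start ns k + i" and ?j = "block_start ns l + j"
      have in_k: "?i < d \<and> g ?i = k" and in_l: "?j < d \<and> g ?j = l"
        using in_block ij that len by auto
      then have "(?i, ?j) \<notin> support_rel U" using supp_le[of ?i ?j] that by auto
      then have "U $$ (?i, ?j) = 0" using nonzero_in_support[OF Uc nn, of ?i ?j] in_k in_l by blast
      then show "mat_block ns U k l $$ (i, j) = 0\<^sub>m (ns ! k) (ns ! l) $$ (i, j)"
        using ij that len block[of k l] by simp
    qed (use that len block in auto)
  qed
  show "\<forall>k<length ns. strictly_pos_mat (mat_block ns U k k)"
  proof (intro allI impI)
    fix k assume "k < length ns"
    then have k: "k < M" using len by simp
    have "0 < U $$ (block_start ns k + i, block_start ns k + j)" if "i < ns ! k" "j < ns ! k" for i j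
      using supp_eq in_block[OF k that(1)] in_block[OF k that(2)] by (fastforce simp: support_rel_def)
    then show "strictly_pos_mat (mat_block ns U k k)"
      by (simp add: strictly_pos_mat_def block[OF k k])
  qed
  show "\<forall>n\<le>length ns. strongly_infinitely_divisible_mat (delete_leading_blocks ns n U)"
  proof (intro allI impI)
    fix n assume "n \<le> length ns"
    then have n: "n \<le> M" using len by simp
    define b where "b = block_start ns n"
    have b: "b \<le> d" using start_le[OF n] by (simp add: b_def)
    have "delete_leading_blocks ns n U = mat (d - b) (d - b) (\<lambda>(i, j). U $$ (b + i, b + j))"
      unfolding delete_leading_blocks_def b_def[symmetric]
      using Uc b by (intro submatrix_interval) auto
    also have "\<dots> = pullback_mat (d - b) ((+) b) U" by (simp add: pullback_mat_def)
    finally have eq: "delete_leading_blocks ns n U = pullback_mat (d - b) ((+) b) U" .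
    have img_b: "(+) b ` {..<d - b} = {b..<d}"
      using b image_add_atLeastLessThan[of b 0 "d - b"] by (simp add: atLeast0LessThan)
    show "strongly_infinitely_divisible_mat (delete_leading_blocks ns n U)"
      unfolding eq
    proof (rule strongly_infinitely_divisible_pullback[OF U dim])
      fix i k assume i: "i \<in> (+) b ` {..<d - b}" and ik: "(i, k) \<in> support_rel U"
      have "i < d" "k < d" "g i \<le> g k" using ik support_subset[OF Uc] supp_le by auto
      moreover have "\<not> i < b" using i by auto
      ultimately have "\<not> k < b" using start_iff[OF n, of i] start_iff[OF n, of k] unfolding b_def by simp
      then show "k \<in> (+) b ` {..<d - b}" unfolding img_b using \<open>k < d\<close> by simp
    qed (auto simp: img_b)
  qed
qed

theorem theorem3:
  fixes B :: "real mat"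
  assumes "strongly_infinitely_divisible_mat B"
  shows "(irreducible_mat B \<longrightarrow> strictly_pos_mat B) \<and>
    (reducible_mat B \<longrightarrow>
      (\<exists>L U ns.
         permutation_mat (dim_row B) L \<and>
         U \<in> carrier_mat (dim_row B) (dim_row B) \<and>
         B = L * U * transpose_mat L \<and>
         infinitely_divisible_mat U \<and>
         upper_block_triangular_mat ns U \<and>
         (\<forall>k<length ns. strictly_pos_mat (mat_block ns U k k)) \<and>
         (\<forall>n\<le>length ns. strongly_infinitely_divisible_mat (delete_leading_blocks ns n U))))"
proof (intro conjI impI)
  show "strictly_pos_mat B" if "irreducible_mat B"
    using irreducible_strictly_pos[OF assms that] .
  define d where "d = dim_row B"
  have B: "B \<in> carrier_mat d d"
    using assms unfolding strongly_infinitely_divisible_mat_def infinitely_divisible_mat_def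
    by (auto simp: d_def)
  note supp = strongly_infinitely_divisible_support[OF assms d_def[symmetric]]
  obtain f :: "nat \<Rightarrow> nat" and M where f: "f ` {..<d} = {..<M}"
    "\<And>i j. (i, j) \<in> support_rel B \<Longrightarrow> f i \<le> f j"
    "\<And>i j. i < d \<Longrightarrow> j < d \<Longrightarrow> f i = f j \<Longrightarrow> (i, j) \<in> support_rel B"
    using preorder_levels[OF support_subset[OF B] supp(1,2)] by metis
  obtain p where p: "p permutes {..<d}" and mono: "\<And>i j. i \<le> j \<Longrightarrow> j < d \<Longrightarrow> f (p i) \<le> f (p j)"
    using sorting_permutation[where f = f and d = d] by metis
  have p_less: "p i < d" if "i < d" for i using permutes_in_image[OF p, of i] that by simp
  have p_img: "p ` {..<d} = {..<d}" by (rule permutes_image[OF p])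
  define U where "U = pullback_mat d p B"
  define L where "L = mat d d (\<lambda>(i, j). if i = p j then 1 else (0 :: real))"
  have "L * U * transpose_mat L = pullback_mat d (Hilbert_Choice.inv p) U"
    using permutation_mat_conjugate[OF p _ L_def, of U] by (simp add: U_def)
  also have "\<dots> = B"
    using B permutes_in_image[OF permutes_inv[OF p]]
    by (intro eq_matI) (auto simp: pullback_mat_def U_def permutes_inverses[OF p])
  finally have LUL: "B = L * U * transpose_mat L" by simp
  have perm: "permutation_mat d L" unfolding permutation_mat_def using p L_def by blast
  have sid: "strongly_infinitely_divisible_mat U"
    unfolding U_def
  proof (rule strongly_infinitely_divisible_pullback[OF assms d_def[symmetric]])
    show "inj_on p {..<d}" by (rule permutes_inj_on[OF p])
    show "p ` {..<d} \<subseteq> {..<d}" using p_img by simp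
    show "k \<in> p ` {..<d}" if "(i, k) \<in> support_rel B" for i k
      using that support_subset[OF B] unfolding p_img by blast
  qed
  have supp_U: "(i, j) \<in> support_rel U \<longleftrightarrow> i < d \<and> j < d \<and> (p i, p j) \<in> support_rel B" for i j
  proof (cases "i < d \<and> j < d")
    case True
    then have "U $$ (i, j) = B $$ (p i, p j)" by (simp add: U_def pullback_mat_def)
    moreover have "p i < d" "p j < d" using True p_less by auto
    ultimately show ?thesis using True B by (simp add: support_rel_def U_def)
  qed (auto simp: support_rel_def U_def)
  have img: "(\<lambda>i. f (p i)) ` {..<d} = {..<M}" using f(1) p_img by (metis image_image)
  let ?ns = "map (\<lambda>k. card {i. i < d \<and> f (p i) = k}) [0..<M]"
  have dim: "dim_row U = d" by (simp add: U_def)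
  have le: "f (p i) \<le> f (p j)" if "(i, j) \<in> support_rel U" for i j
    using that f(2) supp_U by blast
  have eq: "(i, j) \<in> support_rel U" if "i < d" "j < d" "f (p i) = f (p j)" for i j
    unfolding supp_U using that f(3)[OF p_less p_less] by simp
  have "infinitely_divisible_mat U" using sid by (simp add: strongly_infinitely_divisible_mat_def)
  moreover have "U \<in> carrier_mat d d" by (simp add: U_def)
  moreover note perm LUL
    sorted_block_structure[where g = "\<lambda>i. f (p i)", OF sid dim mono img le eq]
  ultimately show "\<exists>L U ns. permutation_mat (dim_row B) L \<and> U \<in> carrier_mat (dim_row B) (dim_row B) \<and>
      B = L * U * transpose_mat L \<and> infinitely_divisible_mat U \<and> upper_block_triangular_mat ns U \<and>
      (\<forall>k<length ns. strictly_pos_mat (mat_block ns U k k)) \<and>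
      (\<forall>n\<le>length ns. strongly_infinitely_divisible_mat (delete_leading_blocks ns n U))"
    unfolding d_def[symmetric] by (intro exI[of _ L] exI[of _ U] exI[of _ ?ns] conjI)
qed

end
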